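(* Let $\beta_1>\beta_2>\cdots$ be a sequence of positive numbers with $\lim_{m\to\infty}\beta_m=0$ and with $\beta_1$ sufficiently large that $h(\cdot,\beta_1)$ is convex on $\{x\in\mathbb{R}^n:-\frac qp<x_i<\frac qp,\ i=1,\dots,n\}$, and let $\beta=\beta_m$ be any fixed term of this sequence. Let $x^0$ be an arbitrary nonzero vector in $\mathbb{R}^n$ with $-\frac qp<x^0_i<\frac qp$ for all $i$ and $x^0_s+x^0_t=0$. Let $(x^k)_{k\ge0}$ be generated by $$x^{k+1}=x^k+\mu_k\left(d(x^k,\lambda(x^k))-x^k\right),\qquad k=0,1,2,\dots,$$ where $\mu_k\in[0,1]$ satisfies $$h(x^{k+1},\beta)=\min_{\mu\in[0,1]}h\left(x^k+\mu\left(d(x^k,\lambda(x^k))-x^k\right),\beta\right).$$ Then every limit point of the sequence $(x^k)$ is a stationary point of the problem of minimizing $h(x,\beta)=f(x)+\beta b(x)$ subject to $x_s+x_t=0$.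
   Context: Let $G=(V,E)$ be a graph with node set $V=\{1,2,\dots,n\}$, and let $W=(w_{ij})_{n\times n}$ be a real symmetric weight matrix with zero diagonal and $w_{ij}>0$ for all $(i,j)\in E$. Fix two nodes $s<t$ in $V$, a real number $\alpha>0$, and real numbers $p,q>0$. Let $I$ be the $n\times n$ identity matrix. Define $f(x)=\frac12 x^T(W-\alpha I)x$ for $x\in\mathbb{R}^n$. The logarithmic barrier function, defined for $-\frac{q}{p}<x_i<\frac{q}{p}$ ($i=1,\dots,n$), is $b(x)=-\sum_{i=1}^n\left[\ln(px_i+q)+\ln(q-px_i)\right]$. For a barrier parameter $\beta>0$, put $h(x,\beta)=f(x)+\beta b(x)$. For $\lambda\in\mathbb{R}$ and $i=1,\dots,n$, set $v_i=0$ if $i\notin\{s,t\}$ and $v_i=\lambda$ if $i\in\{s,t\}$, and put $g_i=\frac{\partial f(x)}{\partial x_i}-v_i$. Define $$d_i(x,\lambda)=\frac{-q^2 g_i}{p\left(\beta p+\sqrt{\beta^2p^2+q^2g_i^2}\right)},\qquad d(x,\lambda)=(d_1(x,\lambda),\dots,d_n(x,\lambda))^T.$$ For $g_i\neq0$ this equals $\frac{\beta p-\sqrt{\beta^2p^2+q^2g_i^2}}{p\,g_i}$, and for $g_i=0$ it equals $0$. In particular $-\frac qp<d_i(x,\lambda)<\frac qp$, so all iterates stay in the domain of $b$. The Lagrange multiplier update is $\lambda(x)=\frac12\left(\frac{\partial f(x)}{\partial x_s}+\frac{\partial f(x)}{\partial x_t}\right)$, which is a solution $\lambda$ of $d_s(x,\lambda)+d_t(x,\lambda)=0$.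 Let $e_{st}\in\mathbb{R}^n$ be the vector whose $s$-th and $t$-th entries are $1$ and whose other entries are $0$. A stationary point of the problem of minimizing $h(x,\beta)$ subject to $x_s+x_t=0$ is a point $x$ with $-\frac qp<x_i<\frac qp$ for all $i$ and $x_s+x_t=0$ for which there is $\lambda\in\mathbb{R}$ with $\nabla_xh(x,\beta)-\lambda e_{st}=0$ (the first-order necessary optimality condition). *)

theory Defs
  imports "HOL-Analysis.Analysis"
begin

definition partial_deriv :: "(real ^ 'n \<Rightarrow> real) \<Rightarrow> 'n::finite \<Rightarrow> real ^ 'n \<Rightarrow> real" where
  "partial_deriv F i x = deriv (\<lambda>u. F (x + u *\<^sub>R axis i 1)) 0"

definition obj :: "real ^ 'n ^ 'n \<Rightarrow> real \<Rightarrow> real ^ 'n::finite \<Rightarrow> real" where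
  "obj W \<alpha> x = 1 / 2 * (x \<bullet> ((W - \<alpha> *\<^sub>R mat 1) *v x))"

definition open_cube :: "real \<Rightarrow> real \<Rightarrow> (real ^ 'n::finite) set" where
  "open_cube p q = {x. \<forall>i. - (q / p) < x $ i \<and> x $ i < q / p}"

text \<open>The barrier is meaningful only on \<open>open_cube p q\<close>, where both logarithms have
  positive arguments; elsewhere the value comes from the totalised logarithm.\<close>

definition barrier :: "real \<Rightarrow> real \<Rightarrow> real ^ 'n::finite \<Rightarrow> real" where
  "barrier p q x = - (\<Sum>i\<in>UNIV. ln (p * x $ i + q) + ln (q - p * x $ i))"

definition barrier_obj ::
  "real ^ 'n ^ 'n \<Rightarrow> real \<Rightarrow> real \<Rightarrow> real \<Rightarrow> real ^ 'n::finite \<Rightarrow> real \<Rightarrow> real" where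
  "barrier_obj W \<alpha> p q x \<beta> = obj W \<alpha> x + \<beta> * barrier p q x"

definition e_st :: "'n::finite \<Rightarrow> 'n \<Rightarrow> real ^ 'n" where
  "e_st s t = (\<chi> i. if i \<in> {s, t} then 1 else 0)"

definition red_grad ::
  "real ^ 'n ^ 'n \<Rightarrow> real \<Rightarrow> 'n \<Rightarrow> 'n \<Rightarrow> real ^ 'n::finite \<Rightarrow> real \<Rightarrow> 'n \<Rightarrow> real" where
  "red_grad W \<alpha> s t x lam i =
     partial_deriv (obj W \<alpha>) i x - (if i \<in> {s, t} then lam else 0)"

definition dir ::
  "real ^ 'n ^ 'n \<Rightarrow> real \<Rightarrow> real \<Rightarrow> real \<Rightarrow> 'n \<Rightarrow> 'n \<Rightarrow> real \<Rightarrow> real ^ 'n::finite \<Rightarrow> real \<Rightarrow> real ^ 'n" where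
  "dir W \<alpha> p q s t \<beta> x lam =
     (\<chi> i. let g = red_grad W \<alpha> s t x lam i
           in - (q\<^sup>2 * g) / (p * (\<beta> * p + sqrt (\<beta>\<^sup>2 * p\<^sup>2 + q\<^sup>2 * g\<^sup>2))))"

definition multiplier ::
  "real ^ 'n ^ 'n \<Rightarrow> real \<Rightarrow> 'n \<Rightarrow> 'n \<Rightarrow> real ^ 'n::finite \<Rightarrow> real" where
  "multiplier W \<alpha> s t x =
     1 / 2 * (partial_deriv (obj W \<alpha>) s x + partial_deriv (obj W \<alpha>) t x)"

definition stationary_point ::
  "real ^ 'n ^ 'n \<Rightarrow> real \<Rightarrow> real \<Rightarrow> real \<Rightarrow> 'n \<Rightarrow> 'n \<Rightarrow> real \<Rightarrow> real ^ 'n::finite \<Rightarrow> bool" where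
  "stationary_point W \<alpha> p q s t \<beta> x \<longleftrightarrow>
     x \<in> open_cube p q \<and> x $ s + x $ t = 0 \<and>
     (\<exists>lam D. GDERIV (\<lambda>y. barrier_obj W \<alpha> p q y \<beta>) x :> D \<and> D - lam *\<^sub>R e_st s t = 0)"

text \<open>A limit point of a sequence is the limit of one of its subsequences; this is not
  an accumulation point of its range, e.g. when the sequence is eventually constant.\<close>

definition seq_limit_point :: "(nat \<Rightarrow> 'a::topological_space) \<Rightarrow> 'a \<Rightarrow> bool" where
  "seq_limit_point X l \<longleftrightarrow> (\<exists>r. strict_mono r \<and> (X \<circ> r) \<longlonglongrightarrow> l)"

end

theory Submission imports Defs begin

text \<open>Write \<open>d y\<close> for the search target at \<open>y\<close>, computed with the multiplier of \<open>y\<close>.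
  Its \<open>i\<close>-th coordinate is the minimiser over the open interval of the strictly convex
  function \<open>u \<mapsto> g\<^sub>i u - \<beta> (ln (p u + q) + ln (q - p u))\<close>, so that
  \<open>g\<^sub>i = - \<beta> \<phi> (d\<^sub>i)\<close> with \<open>\<phi>\<close> the derivative of the one-dimensional barrier
  (lemma \<open>barrier_slope_barrier_root\<close>). On the hyperplane \<open>x\<^sub>s + x\<^sub>t = 0\<close> the multiplier term
  drops out of the directional derivative of the barrier objective along \<open>d y - y\<close>, which
  thus equals \<open>\<beta> (\<Sum>i. (\<phi> (y\<^sub>i) - \<phi> (d\<^sub>i)) (d\<^sub>i - y\<^sub>i))\<close>; because \<open>\<phi>\<close> is strictly increasing,
  this is negative unless \<open>d y = y\<close> (lemma \<open>target_descent\<close>), and \<open>d y = y\<close> says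
  exactly that \<open>y\<close> is stationary.

  Two further facts give the theorem. The map \<open>d\<close> is continuous and sends the closed
  cube into the open one; by compactness it sends it into a smaller closed cube, so
  the iterates stay in a compact subset of the open cube and every limit point lies in
  the open cube. And exact line search towards a continuous target cannot have a limit
  point from which the objective decreases to first order towards the target: near such a point every
  step would lower the objective by a fixed amount (lemma \<open>line_search_limit_no_descent\<close>).\<close>

section \<open>Line search towards a continuous target\<close>

text \<open>Only the inequality that compares the next value with every point of the segment is
  needed, so the lemma covers exact line search and anything better.\<close>

lemma line_search_limit_no_descent:
  fixes h :: "'a::real_normed_vector \<Rightarrow> real" and T :: "'a \<Rightarrow> 'a" and x :: "nat \<Rightarrow> 'a"
  assumes h: "\<And>y. y \<in> S \<Longrightarrow> isCont h y"
    and seg: "\<And>\<nu>. \<nu> \<in> {0..1} \<Longrightarrow> z + \<nu> *\<^sub>R (T z - z) \<in> S"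
    and T: "isCont T z"
    and step: "\<And>k \<nu>. \<nu> \<in> {0..1} \<Longrightarrow> h (x (Suc k)) \<le> h (x k + \<nu> *\<^sub>R (T (x k) - x k))"
    and lim: "seq_limit_point x z"
    and der: "(h has_derivative h') (at z)"
  shows "h' (T z - z) \<ge> 0"
proof (rule ccontr)
  assume "\<not> h' (T z - z) \<ge> 0"
  then have neg: "h' (T z - z) < 0" by simp
  from lim obtain r where r: "strict_mono r" and xr: "(\<lambda>k. x (r k)) \<longlonglongrightarrow> z"
    unfolding seq_limit_point_def o_def by blast
  define v where "v = T z - z"
  have "((\<lambda>\<nu>. h (z + \<nu> *\<^sub>R v)) has_derivative (\<lambda>\<nu>. h' (\<nu> *\<^sub>R v))) (at 0)"
    by (rule has_derivative_compose[where g = h and f = "\<lambda>\<nu>. z + \<nu> *\<^sub>R v"])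
      (auto intro!: derivative_eq_intros simp: der)
  moreover have "h' (\<nu> *\<^sub>R v) = h' v * \<nu>" for \<nu>
    using linear_scale[OF has_derivative_linear[OF der], of \<nu> v] by simp
  ultimately have "DERIV (\<lambda>\<nu>. h (z + \<nu> *\<^sub>R v)) 0 :> h' v"
    by (simp add: has_field_derivative_def fun_eq_iff)
  from DERIV_neg_dec_right[OF this] neg obtain e where
    e: "e > 0" "\<And>\<nu>. 0 < \<nu> \<Longrightarrow> \<nu> < e \<Longrightarrow> h (z + \<nu> *\<^sub>R v) < h z"
    by (auto simp: v_def)
  define \<nu> where "\<nu> = min 1 (e / 2)"
  have \<nu>: "\<nu> \<in> {0..1}" and lt: "h (z + \<nu> *\<^sub>R v) < h z"
    using e(1) by (auto simp: \<nu>_def intro!: e(2))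
  have "z \<in> S" using seg[of 0] by simp
  have dec: "h (x (Suc k)) \<le> h (x k)" for k
    using step[of 0 k] by simp
  then have "decseq (\<lambda>k. h (x k))" by (rule decseq_SucI)
  have "decseq (\<lambda>k. h (x (r k)))"
    using \<open>decseq (\<lambda>k. h (x k))\<close> strict_mono_less_eq[OF r] by (auto simp: decseq_def)
  moreover have lim_h: "(\<lambda>k. h (x (r k))) \<longlonglongrightarrow> h z"
    by (rule isCont_tendsto_compose[OF h xr]) fact
  ultimately have ge: "h z \<le> h (x (r k))" for k
    by (rule decseq_ge)
  \<comment> \<open>The values decrease to \<open>h z\<close>, so no later value can fall below \<open>h z\<close>; but near \<open>z\<close> a step
    of the fixed size \<open>\<nu>\<close> would already achieve that.\<close>
  have "h z \<le> h (x (r k) + \<nu> *\<^sub>R (T (x (r k)) - x (r k)))" for k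
  proof -
    have "h z \<le> h (x (r (Suc k)))" by (rule ge)
    also have "\<dots> \<le> h (x (Suc (r k)))"
      using \<open>decseq (\<lambda>k. h (x k))\<close> r by (auto simp: decseq_def strict_mono_Suc_iff Suc_le_eq)
    also have "\<dots> \<le> h (x (r k) + \<nu> *\<^sub>R (T (x (r k)) - x (r k)))"
      using step[OF \<nu>] .
    finally show ?thesis .
  qed
  moreover have "(\<lambda>k. h (x (r k) + \<nu> *\<^sub>R (T (x (r k)) - x (r k)))) \<longlonglongrightarrow> h (z + \<nu> *\<^sub>R v)"
    unfolding v_def
    by (intro isCont_tendsto_compose[OF h[OF seg[OF \<nu>]]] tendsto_intros xr
        isCont_tendsto_compose[OF T xr])
  ultimately have "h z \<le> h (z + \<nu> *\<^sub>R v)"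
    by (intro LIMSEQ_le_const) auto
  with lt show False by simp
qed

section \<open>The one-dimensional barrier\<close>

text \<open>The derivative of \<open>u \<mapsto> - (ln (p u + q) + ln (q - p u))\<close> on \<open>(- q / p, q / p)\<close>.\<close>

definition barrier_slope :: "real \<Rightarrow> real \<Rightarrow> real \<Rightarrow> real" where
  "barrier_slope p q u = p / (q - p * u) - p / (p * u + q)"

text \<open>The zero in \<open>(- q / p, q / p)\<close> of \<open>u \<mapsto> g + \<beta> * barrier_slope p q u\<close>, in the form that
  is continuous at \<open>g = 0\<close>.\<close>

definition barrier_root :: "real \<Rightarrow> real \<Rightarrow> real \<Rightarrow> real \<Rightarrow> real" where
  "barrier_root p q \<beta> g = - (q\<^sup>2 * g) / (p * (\<beta> * p + sqrt (\<beta>\<^sup>2 * p\<^sup>2 + q\<^sup>2 * g\<^sup>2)))"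

lemma interval_pos:
  fixes p q u :: real
  assumes "p > 0" "\<bar>u\<bar> < q / p"
  shows "p * u + q > 0" "q - p * u > 0"
  using assms by (auto simp: field_simps abs_less_iff)

lemma barrier_slope_strict_mono:
  assumes "p > 0" "\<bar>u\<bar> < q / p" "\<bar>v\<bar> < q / p" "u < v"
  shows "barrier_slope p q u < barrier_slope p q v"
proof -
  note pos = interval_pos[OF assms(1,2)] interval_pos[OF assms(1,3)]
  have "p * u < p * v" using assms by simp
  then have "p / (q - p * u) < p / (q - p * v)" "p / (p * v + q) < p / (p * u + q)"
    using assms pos by (auto intro!: divide_strict_left_mono mult_pos_pos)
  then show ?thesis by (simp add: barrier_slope_def)
qed

lemma barrier_slope_diff_mult_neg:
  assumes "p > 0" "\<bar>u\<bar> < q / p" "\<bar>v\<bar> < q / p" "u \<noteq> v"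
  shows "(barrier_slope p q u - barrier_slope p q v) * (v - u) < 0"
proof (cases "u < v")
  case True
  then show ?thesis
    using barrier_slope_strict_mono[of p u q v] assms by (intro mult_neg_pos) auto
next
  case False
  then show ?thesis
    using barrier_slope_strict_mono[of p v q u] assms by (intro mult_pos_neg) auto
qed

lemma barrier_root_denom_pos:
  fixes p \<beta> :: real
  assumes "p > 0" "\<beta> > 0"
  shows "p * (\<beta> * p + sqrt (\<beta>\<^sup>2 * p\<^sup>2 + q\<^sup>2 * g\<^sup>2)) > 0"
  using assms by (intro mult_pos_pos add_pos_nonneg) auto

lemma abs_barrier_root_less:
  assumes "p > 0" "q > 0" "\<beta> > 0"
  shows "\<bar>barrier_root p q \<beta> g\<bar> < q / p"
proof -
  let ?R = "sqrt (\<beta>\<^sup>2 * p\<^sup>2 + q\<^sup>2 * g\<^sup>2)"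
  have "q * \<bar>g\<bar> = sqrt (q\<^sup>2 * g\<^sup>2)"
    using assms by (simp add: real_sqrt_mult)
  also have "\<dots> \<le> ?R" by simp
  finally have "q * \<bar>g\<bar> < \<beta> * p + ?R"
    using mult_pos_pos[OF assms(3,1)] by linarith
  then have "q * (q * \<bar>g\<bar>) < q * (\<beta> * p + ?R)"
    using assms by simp
  then have "q\<^sup>2 * \<bar>g\<bar> < q / p * (p * (\<beta> * p + ?R))"
    using assms by (simp add: power2_eq_square mult.assoc)
  then have "q\<^sup>2 * \<bar>g\<bar> / (p * (\<beta> * p + ?R)) < q / p"
    by (simp only: pos_divide_less_eq[OF barrier_root_denom_pos[OF assms(1,3)]])
  moreover have "\<bar>p * (\<beta> * p + ?R)\<bar> = p * (\<beta> * p + ?R)"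
    by (rule abs_of_pos[OF barrier_root_denom_pos[OF assms(1,3)]])
  ultimately show ?thesis
    by (simp only: barrier_root_def abs_divide abs_minus_cancel abs_mult[of "q\<^sup>2"] abs_power2)
qed

lemma barrier_slope_barrier_root:
  assumes "p > 0" "q > 0" "\<beta> > 0"
  shows "\<beta> * barrier_slope p q (barrier_root p q \<beta> g) = - g"
proof -
  define R where "R = sqrt (\<beta>\<^sup>2 * p\<^sup>2 + q\<^sup>2 * g\<^sup>2)"
  define u where "u = barrier_root p q \<beta> g"
  have R2: "R * R = \<beta> * \<beta> * p * p + q * q * g * g"
    by (simp add: R_def power2_eq_square)
  have den: "\<beta> * p + R > 0"
    using barrier_root_denom_pos[OF assms(1,3), of q g] assms
    by (simp add: R_def zero_less_mult_iff)
  \<comment> \<open>\<open>B\<close> is the denominator of \<open>p * u\<close>; the identity for \<open>g\<close> is checked after clearing it,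
    where \<open>B\<close> satisfies the quadratic equation \<open>B2\<close>.\<close>
  define B where "B = \<beta> * p + R"
  have B: "B > 0" using den by (simp add: B_def)
  have puB: "p * u * B = - (q * q * g)"
    using assms B by (simp add: u_def barrier_root_def R_def B_def power2_eq_square)
  have B2: "B * B = 2 * \<beta> * p * B + q * q * g * g"
    using R2 by (simp add: B_def algebra_simps)
  \<comment> \<open>What has to vanish is \<open>\<beta> * barrier_slope p q u + g\<close> times \<open>(q - p * u) * (p * u + q)\<close>.\<close>
  note pos = interval_pos[OF assms(1) abs_barrier_root_less[OF assms, of g], folded u_def]
  have "(2 * \<beta> * p * (p * u) + g * (q - p * u) * (p * u + q)) * (B * B)
      = 2 * \<beta> * p * B * (p * u * B) + g * q * q * (B * B) - g * (p * u * B) * (p * u * B)"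
    by (simp add: algebra_simps)
  also have "\<dots> = g * q * q * (B * B - 2 * \<beta> * p * B - q * q * g * g)"
    unfolding puB by (simp add: algebra_simps)
  also have "\<dots> = 0" using B2 by simp
  finally have "2 * \<beta> * p * (p * u) + g * (q - p * u) * (p * u + q) = 0"
    using B by simp
  then have "\<beta> * (2 * p * (p * u)) = - g * ((q - p * u) * (p * u + q))"
    by (simp add: algebra_simps)
  moreover have "barrier_slope p q u = 2 * p * (p * u) / ((q - p * u) * (p * u + q))"
    using pos by (simp add: barrier_slope_def diff_frac_eq algebra_simps)
  ultimately show ?thesis
    using pos by (simp add: u_def[symmetric])
qed

lemma barrier_root_minus: "barrier_root p q \<beta> (- g) = - barrier_root p q \<beta> g"
  by (simp add: barrier_root_def)

lemma isCont_barrier_root: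
  assumes "p > 0" "\<beta> > 0"
  shows "isCont (barrier_root p q \<beta>) g"
  unfolding barrier_root_def
  using barrier_root_denom_pos[OF assms, of q g] by (intro continuous_intros) (metis less_irrefl)

section \<open>Gradients of the objective and of the barrier\<close>

lemma mem_open_cube_iff: "y \<in> open_cube p q \<longleftrightarrow> (\<forall>i. \<bar>y $ i\<bar> < q / p)"
  by (auto simp: open_cube_def abs_less_iff minus_less_iff)

lemma partial_deriv_eq:
  fixes F :: "real ^ 'n::finite \<Rightarrow> real"
  assumes "GDERIV F y :> D"
  shows "partial_deriv F i y = D $ i"
proof -
  have F: "(F has_derivative (\<lambda>h. h \<bullet> D)) (at (y + 0 *\<^sub>R axis i 1))"
    using assms by (simp add: gderiv_def)
  have "((\<lambda>u. F (y + u *\<^sub>R axis i 1)) has_derivative (\<lambda>u. (u *\<^sub>R axis i 1) \<bullet> D)) (at 0)"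
    by (rule has_derivative_compose[where g = F and f = "\<lambda>u. y + u *\<^sub>R axis i 1", OF _ F])
      (auto intro!: derivative_eq_intros)
  then have "DERIV (\<lambda>u. F (y + u *\<^sub>R axis i 1)) 0 :> D $ i"
    by (simp add: has_field_derivative_def inner_axis' mult.commute[of _ "D $ i"])
  then show ?thesis
    unfolding partial_deriv_def by (rule DERIV_imp_deriv)
qed

lemma gderiv_obj:
  fixes W :: "real ^ 'n ^ 'n::finite"
  assumes "transpose W = W"
  shows "GDERIV (obj W \<alpha>) y :> (W - \<alpha> *\<^sub>R mat 1) *v y"
proof -
  define M where "M = W - \<alpha> *\<^sub>R mat 1"
  have "transpose M = M"
    using assms by (simp add: M_def transpose_def mat_def vec_eq_iff)
  then have sym: "h \<bullet> (M *v y) + y \<bullet> (M *v h) = 2 * (h \<bullet> (M *v y))" for h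
    by (metis dot_lmul_matrix inner_commute mult_2 transpose_matrix_vector)
  have lin: "((*v) M has_derivative (*v) M) (at y)"
    by (intro bounded_linear_imp_has_derivative matrix_vector_mul_bounded_linear)
  have "((\<lambda>y. 1 / 2 * (y \<bullet> (M *v y))) has_derivative (\<lambda>h. h \<bullet> (M *v y))) (at y)"
    by (auto intro!: derivative_eq_intros lin simp: fun_eq_iff sym add.commute)
  then show ?thesis
    by (simp add: gderiv_def obj_def[abs_def] M_def)
qed

lemma gderiv_barrier:
  fixes y :: "real ^ 'n::finite"
  assumes "p > 0" and y: "y \<in> open_cube p q"
  shows "GDERIV (barrier p q) y :> (\<chi> i. barrier_slope p q (y $ i))"
proof -
  have pos: "p * y $ i + q > 0" "q - p * y $ i > 0" for i
    using y interval_pos[OF \<open>p > 0\<close>, of "y $ i" q] by (auto simp: mem_open_cube_iff)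
  have nth: "((\<lambda>y :: real ^ 'n. y $ i) has_derivative (\<lambda>h. h $ i)) (at y)" for i
    by (intro bounded_linear_imp_has_derivative bounded_linear_vec_nth)
  have coord: "((\<lambda>y. ln (p * y $ i + q) + ln (q - p * y $ i)) has_derivative
      (\<lambda>h. - (h $ i * barrier_slope p q (y $ i)))) (at y)" for i
    by (rule derivative_eq_intros nth refl pos)+
      (use pos[of i] in \<open>auto simp: fun_eq_iff barrier_slope_def field_simps\<close>)
  have "((\<lambda>y. - (\<Sum>i\<in>UNIV. ln (p * y $ i + q) + ln (q - p * y $ i))) has_derivative
      (\<lambda>h. - (\<Sum>i\<in>UNIV. - (h $ i * barrier_slope p q (y $ i))))) (at y)"
    by (intro has_derivative_minus has_derivative_sum coord)
  then show ?thesis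
    by (simp add: gderiv_def barrier_def[abs_def] inner_vec_def sum_negf)
qed

lemma gderiv_barrier_obj:
  fixes W :: "real ^ 'n ^ 'n::finite"
  assumes "transpose W = W" "p > 0" "y \<in> open_cube p q"
  shows "GDERIV (\<lambda>y. barrier_obj W \<alpha> p q y \<beta>) y :>
    ((W - \<alpha> *\<^sub>R mat 1) *v y + \<beta> *\<^sub>R (\<chi> i. barrier_slope p q (y $ i)))"
proof -
  have "GDERIV (\<lambda>y. \<beta> * barrier p q y) y :> \<beta> *\<^sub>R (\<chi> i. barrier_slope p q (y $ i))"
    using gderiv_barrier[OF assms(2,3)]
    by (auto simp: gderiv_def intro!: derivative_eq_intros)
  from GDERIV_add[OF gderiv_obj[OF assms(1)] this] show ?thesis
    by (simp add: barrier_obj_def[abs_def])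
qed

section \<open>The search target\<close>

text \<open>The target of the search direction at \<open>y\<close>, with the multiplier updated at \<open>y\<close>.\<close>

definition target ::
  "real ^ 'n ^ 'n \<Rightarrow> real \<Rightarrow> real \<Rightarrow> real \<Rightarrow> 'n \<Rightarrow> 'n \<Rightarrow> real \<Rightarrow> real ^ 'n::finite \<Rightarrow> real ^ 'n" where
  "target W \<alpha> p q s t \<beta> y = dir W \<alpha> p q s t \<beta> y (multiplier W \<alpha> s t y)"

lemma target_nth:
  "target W \<alpha> p q s t \<beta> y $ i
     = barrier_root p q \<beta> (red_grad W \<alpha> s t y (multiplier W \<alpha> s t y) i)"
  by (simp add: target_def dir_def barrier_root_def Let_def)

lemma red_grad_eq:
  fixes W :: "real ^ 'n ^ 'n::finite"
  assumes "transpose W = W"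
  shows "red_grad W \<alpha> s t y lam i = ((W - \<alpha> *\<^sub>R mat 1) *v y - lam *\<^sub>R e_st s t) $ i"
  by (simp add: red_grad_def partial_deriv_eq[OF gderiv_obj[OF assms]] e_st_def)

lemma multiplier_eq:
  fixes W :: "real ^ 'n ^ 'n::finite"
  assumes "transpose W = W"
  shows "multiplier W \<alpha> s t y
    = (((W - \<alpha> *\<^sub>R mat 1) *v y) $ s + ((W - \<alpha> *\<^sub>R mat 1) *v y) $ t) / 2"
  by (simp add: multiplier_def partial_deriv_eq[OF gderiv_obj[OF assms]])

lemma target_mem_open_cube:
  assumes "p > 0" "q > 0" "\<beta> > 0"
  shows "target W \<alpha> p q s t \<beta> y \<in> open_cube p q"
  using abs_barrier_root_less[OF assms] by (simp add: mem_open_cube_iff target_nth)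

lemma isCont_target:
  fixes W :: "real ^ 'n ^ 'n::finite"
  assumes "transpose W = W" "p > 0" "\<beta> > 0"
  shows "isCont (target W \<alpha> p q s t \<beta>) y"
proof -
  have lin: "isCont (\<lambda>y. ((W - \<alpha> *\<^sub>R mat 1) *v y) $ i) y" for i
    by (intro continuous_intros matrix_vector_mul_bounded_linear[THEN linear_continuous_at])
  have "isCont (\<lambda>y. target W \<alpha> p q s t \<beta> y $ i) y" for i
    unfolding target_nth red_grad_eq[OF assms(1)] multiplier_eq[OF assms(1)]
    by (intro isCont_o2[OF _ isCont_barrier_root[OF assms(2,3)]])
      (simp, intro continuous_intros lin, simp)
  then show ?thesis
    by (simp add: isCont_def vec_tendstoI)
qed

lemma target_sum_zero:
  fixes W :: "real ^ 'n ^ 'n::finite"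
  assumes "transpose W = W"
  shows "target W \<alpha> p q s t \<beta> y $ s + target W \<alpha> p q s t \<beta> y $ t = 0"
proof -
  let ?g = "red_grad W \<alpha> s t y (multiplier W \<alpha> s t y)"
  have "?g t = - ?g s"
    by (simp add: red_grad_eq[OF assms] multiplier_eq[OF assms] e_st_def field_simps)
  then show ?thesis by (simp add: target_nth barrier_root_minus)
qed

text \<open>The gradient of the Lagrangian at \<open>y\<close>, rewritten by means of the equation that each
  coordinate of the target solves.\<close>

lemma gradient_eq_slopes:
  fixes W :: "real ^ 'n ^ 'n::finite"
  assumes "transpose W = W" "p > 0" "q > 0" "\<beta> > 0"
  shows "(W - \<alpha> *\<^sub>R mat 1) *v y + \<beta> *\<^sub>R (\<chi> i. barrier_slope p q (y $ i))
    - multiplier W \<alpha> s t y *\<^sub>R e_st s t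
    = \<beta> *\<^sub>R (\<chi> i. barrier_slope p q (y $ i) - barrier_slope p q (target W \<alpha> p q s t \<beta> y $ i))"
  using barrier_slope_barrier_root[OF assms(2-4)]
  by (simp add: vec_eq_iff target_nth right_diff_distrib red_grad_eq[OF assms(1)])

lemma e_st_inner:
  assumes "s \<noteq> t"
  shows "v \<bullet> e_st s t = v $ s + v $ t"
proof -
  have "v \<bullet> e_st s t = (\<Sum>i\<in>UNIV. if i \<in> {s, t} then v $ i else 0)"
    by (simp add: inner_vec_def e_st_def if_distrib cong: if_cong)
  also have "\<dots> = sum (($) v) {s, t}"
    by (subst sum.inter_restrict[symmetric]) auto
  finally show ?thesis using assms by simp
qed

lemma target_descent:
  fixes W :: "real ^ 'n ^ 'n::finite"
  assumes "transpose W = W" "p > 0" "q > 0" "\<beta> > 0" "s \<noteq> t"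
    and y: "y \<in> open_cube p q" "y $ s + y $ t = 0"
    and ne: "target W \<alpha> p q s t \<beta> y \<noteq> y"
  shows "(target W \<alpha> p q s t \<beta> y - y)
    \<bullet> ((W - \<alpha> *\<^sub>R mat 1) *v y + \<beta> *\<^sub>R (\<chi> i. barrier_slope p q (y $ i))) < 0"
    (is "?v \<bullet> ?D < 0")
proof -
  let ?d = "target W \<alpha> p q s t \<beta> y" and ?\<phi> = "barrier_slope p q"
  have cube: "\<bar>?d $ i\<bar> < q / p" "\<bar>y $ i\<bar> < q / p" for i
    using target_mem_open_cube[OF assms(2-4), of W \<alpha> s t y] y by (auto simp: mem_open_cube_iff)
  have "?v \<bullet> e_st s t = 0"
    using target_sum_zero[OF assms(1), of \<alpha> p q s t \<beta> y] y
    by (simp add: e_st_inner[OF assms(5)])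
  then have "?v \<bullet> ?D = ?v \<bullet> (?D - multiplier W \<alpha> s t y *\<^sub>R e_st s t)"
    by (simp only: inner_diff_right inner_scaleR_right)
  also have "\<dots> = \<beta> * (\<Sum>i\<in>UNIV. (?\<phi> (y $ i) - ?\<phi> (?d $ i)) * (?d $ i - y $ i))"
    unfolding gradient_eq_slopes[OF assms(1-4)]
    by (simp add: inner_vec_def sum_distrib_left mult_ac)
  also have "\<dots> < \<beta> * 0"
  proof (rule mult_strict_left_mono)
    from ne obtain j where j: "?d $ j \<noteq> y $ j" by (auto simp: vec_eq_iff)
    have neg: "(?\<phi> (y $ i) - ?\<phi> (?d $ i)) * (?d $ i - y $ i) < 0" if "?d $ i \<noteq> y $ i" for i
      using barrier_slope_diff_mult_neg[OF assms(2) cube(2) cube(1)] that by metis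
    have "(\<Sum>i\<in>UNIV. (?\<phi> (y $ i) - ?\<phi> (?d $ i)) * (?d $ i - y $ i)) < (\<Sum>i::'n\<in>UNIV. 0)"
    proof (rule sum_strict_mono_ex1)
      show "\<forall>i\<in>UNIV. (?\<phi> (y $ i) - ?\<phi> (?d $ i)) * (?d $ i - y $ i) \<le> 0"
        using neg by (metis less_imp_le cancel_comm_monoid_add_class.diff_cancel mult_zero_right order_refl)
    qed (use neg j in auto)
    then show "(\<Sum>i\<in>UNIV. (?\<phi> (y $ i) - ?\<phi> (?d $ i)) * (?d $ i - y $ i)) < 0" by simp
  qed (fact assms(4))
  finally show ?thesis by simp
qed

text \<open>A fixed point of the target map solves the first-order conditions with the multiplier
  used by the update.\<close>

lemma stationary_point_if_target_fixed:
  fixes W :: "real ^ 'n ^ 'n::finite"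
  assumes "transpose W = W" "p > 0" "q > 0" "\<beta> > 0"
    and y: "y \<in> open_cube p q" "y $ s + y $ t = 0"
    and fixed: "target W \<alpha> p q s t \<beta> y = y"
  shows "stationary_point W \<alpha> p q s t \<beta> y"
proof -
  have "(W - \<alpha> *\<^sub>R mat 1) *v y + \<beta> *\<^sub>R (\<chi> i. barrier_slope p q (y $ i))
      - multiplier W \<alpha> s t y *\<^sub>R e_st s t = 0"
    unfolding gradient_eq_slopes[OF assms(1-4)] fixed by (simp add: vec_eq_iff)
  with gderiv_barrier_obj[OF assms(1,2) y(1), of \<alpha> \<beta>] y show ?thesis
    unfolding stationary_point_def by blast
qed

section \<open>The iterates\<close>

lemma segment_coord_bound:
  fixes y v :: "real ^ 'n::finite"
  assumes "\<bar>y $ i\<bar> \<le> c" "\<bar>v $ i\<bar> \<le> c" "\<nu> \<in> {0..1}"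
  shows "\<bar>(y + \<nu> *\<^sub>R (v - y)) $ i\<bar> \<le> c"
proof -
  have "(y + \<nu> *\<^sub>R (v - y)) $ i = (1 - \<nu>) * y $ i + \<nu> * v $ i"
    by (simp add: algebra_simps)
  also have "\<bar>\<dots>\<bar> \<le> (1 - \<nu>) * \<bar>y $ i\<bar> + \<nu> * \<bar>v $ i\<bar>"
    using assms(3) abs_triangle_ineq[of "(1 - \<nu>) * y $ i" "\<nu> * v $ i"] by (simp add: abs_mult)
  also have "\<dots> \<le> c"
    using assms by (intro convex_bound_le) auto
  finally show ?thesis .
qed

lemma segment_mem_open_cube:
  assumes "y \<in> open_cube p q" "v \<in> open_cube p q" "\<nu> \<in> {0..1}"
  shows "y + \<nu> *\<^sub>R (v - y) \<in> open_cube p q"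
  unfolding mem_open_cube_iff
proof
  fix i
  have "\<bar>(y + \<nu> *\<^sub>R (v - y)) $ i\<bar> \<le> max \<bar>y $ i\<bar> \<bar>v $ i\<bar>"
    by (rule segment_coord_bound) (use assms in auto)
  also have "\<dots> < q / p" using assms by (simp add: mem_open_cube_iff)
  finally show "\<bar>(y + \<nu> *\<^sub>R (v - y)) $ i\<bar> < q / p" .
qed

text \<open>This bound keeps the iterates away from the boundary: a closed box that contains the
  starting point and all targets is invariant under the iteration. It holds because the
  targets of the points of the compact closed cube form a compact subset of the open cube.\<close>

lemma target_uniform_bound:
  fixes W :: "real ^ 'n ^ 'n::finite"
  assumes "transpose W = W" "p > 0" "q > 0" "\<beta> > 0"
  obtains c where "c < q / p"
    "\<And>y i. y \<in> open_cube p q \<Longrightarrow> \<bar>target W \<alpha> p q s t \<beta> y $ i\<bar> \<le> c"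
proof -
  let ?K = "cbox (\<chi> i. - (q / p)) (\<chi> i. q / p) :: (real ^ 'n) set"
  let ?d = "target W \<alpha> p q s t \<beta>"
  have "compact ?K" by simp
  moreover have "0 \<in> ?K" using assms by (simp add: mem_box_cart)
  moreover have "continuous_on ?K (\<lambda>y. infnorm (?d y))"
    using isCont_target[OF assms(1,2,4)]
    by (intro continuous_on_infnorm continuous_at_imp_continuous_on) blast
  ultimately obtain w where w: "\<And>y. y \<in> ?K \<Longrightarrow> infnorm (?d y) \<le> infnorm (?d w)"
    using continuous_attains_sup[of ?K "\<lambda>y. infnorm (?d y)"] by auto
  show thesis
  proof
    obtain j where "infnorm (?d w) = \<bar>?d w $ j\<bar>"
    proof -
      have "infnorm (?d w) \<in> {\<bar>?d w $ i\<bar> | i. i \<in> UNIV}"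
        unfolding infnorm_cart
        by (subst cSup_eq_Max; (intro Max_in)?) (auto simp: full_SetCompr_eq)
      then show thesis using that by auto
    qed
    then show "infnorm (?d w) < q / p"
      using target_mem_open_cube[OF assms(2-4), of W \<alpha> s t w] by (simp add: mem_open_cube_iff)
  next
    fix y :: "real ^ 'n" and i
    assume "y \<in> open_cube p q"
    then have "y \<in> ?K" by (auto simp: open_cube_def mem_box_cart less_imp_le)
    then show "\<bar>?d y $ i\<bar> \<le> infnorm (?d w)"
      using w component_le_infnorm_cart[of "?d y" i] by fastforce
  qed
qed

theorem theorem1:
  fixes E :: "('n::{finite,linorder} \<times> 'n) set"
    and W :: "real ^ 'n::{finite,linorder} ^ 'n::{finite,linorder}"
    and s t :: 'n
    and \<alpha> p q :: real
    and \<beta> :: "nat \<Rightarrow> real" and m :: nat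
    and x :: "nat \<Rightarrow> real ^ 'n::{finite,linorder}" and \<mu> :: "nat \<Rightarrow> real"
    and z :: "real ^ 'n::{finite,linorder}"
  assumes "transpose W = W"
    and "\<And>i. W $ i $ i = 0"
    and "\<And>i j. (i, j) \<in> E \<Longrightarrow> W $ i $ j > 0"
    and "s < t"
    and "\<alpha> > 0" and "p > 0" and "q > 0"
    and "\<And>k. k \<ge> 1 \<Longrightarrow> \<beta> k > 0"
    and "\<And>k. k \<ge> 1 \<Longrightarrow> \<beta> (Suc k) < \<beta> k"
    and "\<beta> \<longlonglongrightarrow> 0"
    and "convex_on (open_cube p q) (\<lambda>y. barrier_obj W \<alpha> p q y (\<beta> 1))"
    and "m \<ge> 1"
    and "x 0 \<noteq> 0" and "x 0 \<in> open_cube p q" and "x 0 $ s + x 0 $ t = 0"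
    and "\<And>k. x (Suc k) =
           x k + \<mu> k *\<^sub>R (dir W \<alpha> p q s t (\<beta> m) (x k) (multiplier W \<alpha> s t (x k)) - x k)"
    and "\<And>k. is_arg_min
           (\<lambda>\<nu>. barrier_obj W \<alpha> p q
              (x k + \<nu> *\<^sub>R (dir W \<alpha> p q s t (\<beta> m) (x k) (multiplier W \<alpha> s t (x k)) - x k)) (\<beta> m))
           (\<lambda>\<nu>. \<nu> \<in> {0..1}) (\<mu> k)"
    and "seq_limit_point x z"
  shows "stationary_point W \<alpha> p q s t (\<beta> m) z"
proof -
  define b where "b = \<beta> m"
  define d where "d = target W \<alpha> p q s t b"
  define h where "h = (\<lambda>y. barrier_obj W \<alpha> p q y b)"
  have b: "b > 0" using assms(8,12) by (simp add: b_def)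
  note par = assms(1,6,7) b
  have "s \<noteq> t" using assms(4) by simp
  have iter: "x (Suc k) = x k + \<mu> k *\<^sub>R (d (x k) - x k)" for k
    using assms(16) by (simp add: d_def b_def target_def)
  have mu: "\<mu> k \<in> {0..1}"
    and step: "\<nu> \<in> {0..1} \<Longrightarrow> h (x (Suc k)) \<le> h (x k + \<nu> *\<^sub>R (d (x k) - x k))" for k \<nu>
    using assms(17)[of k] unfolding iter
    by (auto simp: is_arg_min_linorder d_def b_def h_def target_def)
  have d_cube: "d y \<in> open_cube p q" for y
    unfolding d_def by (rule target_mem_open_cube) fact+
  obtain c where c: "c < q / p" "\<And>y i. y \<in> open_cube p q \<Longrightarrow> \<bar>d y $ i\<bar> \<le> c"
    using target_uniform_bound[OF par] unfolding d_def by metis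
  \<comment> \<open>Half-widths of a closed box that the iterates never leave.\<close>
  define r where "r = (\<lambda>i. max c \<bar>x 0 $ i\<bar>)"
  have r: "r i < q / p" for i
    using c assms(14) by (simp add: r_def mem_open_cube_iff)
  have x_bound: "\<bar>x k $ i\<bar> \<le> r i" and x_cube: "x k \<in> open_cube p q" for k i
  proof -
    have "x k \<in> open_cube p q \<and> (\<forall>i. \<bar>x k $ i\<bar> \<le> r i)"
    proof (induction k)
      case 0
      then show ?case using assms(14) by (simp add: r_def)
    next
      case (Suc k)
      then have "\<bar>d (x k) $ i\<bar> \<le> r i" for i
        using c(2)[of "x k" i] by (simp add: r_def)
      with Suc show ?case
        unfolding iter using segment_mem_open_cube segment_coord_bound d_cube mu by blast
    qed
    then show "\<bar>x k $ i\<bar> \<le> r i" "x k \<in> open_cube p q" by auto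
  qed
  have d_sum: "d y $ s + d y $ t = 0" for y
    unfolding d_def by (rule target_sum_zero) fact
  have x_sum: "x k $ s + x k $ t = 0" for k
  proof (induction k)
    case (Suc k)
    have "x (Suc k) $ s + x (Suc k) $ t
        = (1 - \<mu> k) * (x k $ s + x k $ t) + \<mu> k * (d (x k) $ s + d (x k) $ t)"
      by (simp add: iter algebra_simps)
    then show ?case using Suc d_sum by simp
  qed (fact assms(15))
  from assms(18) obtain l where l: "(\<lambda>k. x (l k)) \<longlonglongrightarrow> z"
    unfolding seq_limit_point_def o_def by blast
  have "\<bar>z $ i\<bar> \<le> r i" for i
    using x_bound by (intro LIMSEQ_le_const2[OF tendsto_rabs[OF tendsto_vec_nth[OF l]]]) auto
  then have z_cube: "z \<in> open_cube p q"
    using r by (auto simp: mem_open_cube_iff intro: le_less_trans)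
  have "(\<lambda>k. x (l k) $ s + x (l k) $ t) \<longlonglongrightarrow> z $ s + z $ t"
    by (intro tendsto_intros l)
  then have z_sum: "z $ s + z $ t = 0"
    by (simp add: x_sum LIMSEQ_const_iff)
  have der: "(h has_derivative (\<lambda>v. v \<bullet> ((W - \<alpha> *\<^sub>R mat 1) *v y
      + b *\<^sub>R (\<chi> i. barrier_slope p q (y $ i))))) (at y)" if "y \<in> open_cube p q" for y
    using gderiv_barrier_obj[OF assms(1,6) that] by (simp add: h_def gderiv_def)
  have "(d z - z) \<bullet> ((W - \<alpha> *\<^sub>R mat 1) *v z + b *\<^sub>R (\<chi> i. barrier_slope p q (z $ i))) \<ge> 0"
  proof (rule line_search_limit_no_descent[where S = "open_cube p q" and T = d])
    show "isCont h y" if "y \<in> open_cube p q" for y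
      using der[OF that] by (rule has_derivative_continuous)
    show "z + \<nu> *\<^sub>R (d z - z) \<in> open_cube p q" if "\<nu> \<in> {0..1}" for \<nu>
      using z_cube d_cube that by (rule segment_mem_open_cube)
    show "isCont d z"
      unfolding d_def by (rule isCont_target) fact+
  qed (fact step assms(18) der[OF z_cube])+
  then have "d z = z"
    using target_descent[OF par \<open>s \<noteq> t\<close> z_cube z_sum, of \<alpha>] unfolding d_def by linarith
  then show ?thesis
    using stationary_point_if_target_fixed[OF par z_cube z_sum] by (simp add: d_def b_def)
qed

end
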